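(* For $n\geq 3$, there exists no non-trivial gradient Riemann soliton $(V,\lambda)$ on a compact $n$-dimensional Riemannian manifold $(M,g)$ with $V$ of constant length (i.e. with $|V|$ constant on $M$).
   Context: Conventions: for $(0,2)$-tensor fields, $(T_1\odot T_2)(X,Y,Z,W)=T_1(X,W)T_2(Y,Z)+T_1(Y,Z)T_2(X,W)-T_1(X,Z)T_2(Y,W)-T_1(Y,W)T_2(X,Z)$ (Kulkarni-Nomizu product). $R$ is the $(0,4)$ Riemann curvature tensor $R(X,Y,Z,W)=g(R(X,Y)Z,W)$, with $R(X,Y)Z=\nabla_X\nabla_YZ-\nabla_Y\nabla_XZ-\nabla_{[X,Y]}Z$ and $\nabla$ the Levi-Civita connection. $G:=\frac12 g\odot g$. A smooth vector field $V$ and a real constant $\lambda$ define a Riemann soliton on $(M,g)$ if $\frac12(\pounds_Vg)\odot g+R=\lambda G$, where $\pounds_V$ is the Lie derivative. It is a gradient Riemann soliton if moreover $V=\operatorname{grad}(f)$ for some smooth function $f$ on $M$. Non-trivial means that $V$ is not identically zero. *)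

theory Defs
  imports "HOL-Analysis.Analysis"
begin

section \<open>Smooth maps between normed spaces\<close>

text \<open>\<open>Ck_on k f S\<close> is meant for open \<open>S\<close>: all iterated directional derivatives of \<open>f\<close> up to
  order \<open>k\<close> exist and are continuous on \<open>S\<close>, those of order less than \<open>k\<close> being totally
  differentiable.\<close>

fun Ck_on :: "nat \<Rightarrow> ('b::real_normed_vector \<Rightarrow> 'c::real_normed_vector) \<Rightarrow> 'b set \<Rightarrow> bool" where
  "Ck_on 0 f S \<longleftrightarrow> continuous_on S f"
| "Ck_on (Suc k) f S \<longleftrightarrow>
     (\<forall>x\<in>S. f differentiable (at x)) \<and> (\<forall>v. Ck_on k (\<lambda>x. frechet_derivative f (at x) v) S)"

definition smooth_on :: "'b::real_normed_vector set \<Rightarrow> ('b \<Rightarrow> 'c::real_normed_vector) \<Rightarrow> bool" where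
  "smooth_on S f \<longleftrightarrow> (\<forall>k. Ck_on k f S)"

section \<open>Smooth manifolds\<close>

text \<open>A chart is a pair \<open>(U, \<phi>)\<close> of its domain and its coordinate map; only the values of \<open>\<phi>\<close> on
  \<open>U\<close> matter. The dimension of the manifold is \<open>CARD('n)\<close>. Manifolds have no boundary and are not
  assumed to be connected.\<close>

type_synonym ('a, 'n) chart = "'a set \<times> ('a \<Rightarrow> real ^ 'n)"

definition is_chart :: "'a topology \<Rightarrow> ('a, 'n::finite) chart \<Rightarrow> bool" where
  "is_chart M c \<longleftrightarrow> (case c of (U, \<phi>) \<Rightarrow>
     openin M U \<and> open (\<phi> ` U) \<and>
     homeomorphic_map (subtopology M U) (top_of_set (\<phi> ` U)) \<phi>)"

definition smooth_manifold :: "'a topology \<Rightarrow> ('a, 'n::finite) chart set \<Rightarrow> bool" where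
  "smooth_manifold M A \<longleftrightarrow>
     Hausdorff_space M \<and> second_countable M \<and>
     (\<forall>c\<in>A. is_chart M c) \<and> (\<Union>(U, \<phi>)\<in>A. U) = topspace M \<and>
     (\<forall>(U, \<phi>)\<in>A. \<forall>(U', \<phi>')\<in>A. smooth_on (\<phi> ` (U \<inter> U')) (\<lambda>x. \<phi>' (inv_into U \<phi> x)))"

text \<open>Elements of \<open>C\<^sup>\<infinity>(M)\<close> are represented by total functions, whose values off \<open>M\<close> are
  irrelevant.\<close>

definition smooth_fun :: "('a, 'n::finite) chart set \<Rightarrow> ('a \<Rightarrow> real) \<Rightarrow> bool" where
  "smooth_fun A f \<longleftrightarrow> (\<forall>(U, \<phi>)\<in>A. smooth_on (\<phi> ` U) (\<lambda>x. f (inv_into U \<phi> x)))"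

definition smooth_curve ::
    "'a topology \<Rightarrow> ('a, 'n::finite) chart set \<Rightarrow> real set \<Rightarrow> (real \<Rightarrow> 'a) \<Rightarrow> bool" where
  "smooth_curve M A I \<gamma> \<longleftrightarrow>
     continuous_map (top_of_set I) M \<gamma> \<and>
     (\<forall>(U, \<phi>)\<in>A. smooth_on {t\<in>I. \<gamma> t \<in> U} (\<lambda>t. \<phi> (\<gamma> t)))"

section \<open>Tangent vectors and vector fields\<close>

text \<open>A tangent vector at \<open>p\<close> is the velocity of a smooth curve through \<open>p\<close>, regarded as the
  operator \<open>f \<mapsto> (f \<circ> \<gamma>)'(0)\<close> on \<open>C\<^sup>\<infinity>(M)\<close>. It is extended by zero to all other
  functions, so that equality of tangent vectors is equality in HOL.\<close>

type_synonym 'a tvec = "('a \<Rightarrow> real) \<Rightarrow> real"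

definition velocity :: "('a, 'n::finite) chart set \<Rightarrow> (real \<Rightarrow> 'a) \<Rightarrow> 'a tvec" where
  "velocity A \<gamma> = (\<lambda>f. if smooth_fun A f then deriv (\<lambda>t. f (\<gamma> t)) 0 else 0)"

definition tangent_space ::
    "'a topology \<Rightarrow> ('a, 'n::finite) chart set \<Rightarrow> 'a \<Rightarrow> 'a tvec set" where
  "tangent_space M A p =
     {velocity A \<gamma> | \<gamma> e. e > 0 \<and> smooth_curve M A {-e<..<e} \<gamma> \<and> \<gamma> 0 = p}"

definition tv_add :: "'a tvec \<Rightarrow> 'a tvec \<Rightarrow> 'a tvec" where
  "tv_add u v = (\<lambda>f. u f + v f)"

definition tv_diff :: "'a tvec \<Rightarrow> 'a tvec \<Rightarrow> 'a tvec" where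
  "tv_diff u v = (\<lambda>f. u f - v f)"

definition tv_scale :: "real \<Rightarrow> 'a tvec \<Rightarrow> 'a tvec" where
  "tv_scale a u = (\<lambda>f. a * u f)"

definition tv_zero :: "'a tvec" where
  "tv_zero = (\<lambda>f. 0)"

text \<open>The values of a vector field at points outside \<open>M\<close> are irrelevant; accordingly, identities
  between vector fields are stated pointwise on \<open>topspace M\<close>.\<close>

type_synonym 'a vfield = "'a \<Rightarrow> 'a tvec"

definition smooth_vfield ::
    "'a topology \<Rightarrow> ('a, 'n::finite) chart set \<Rightarrow> 'a vfield \<Rightarrow> bool" where
  "smooth_vfield M A X \<longleftrightarrow>
     (\<forall>p\<in>topspace M. X p \<in> tangent_space M A p) \<and>
     (\<forall>f. smooth_fun A f \<longrightarrow> smooth_fun A (\<lambda>p. X p f))"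

definition lie_bracket :: "'a vfield \<Rightarrow> 'a vfield \<Rightarrow> 'a vfield" where
  "lie_bracket X Y = (\<lambda>p f. X p (\<lambda>q. Y q f) - Y p (\<lambda>q. X q f))"

section \<open>Riemannian metrics and the Levi-Civita connection\<close>

type_synonym 'a metric_field = "'a \<Rightarrow> 'a tvec \<Rightarrow> 'a tvec \<Rightarrow> real"

definition riemannian_metric ::
    "'a topology \<Rightarrow> ('a, 'n::finite) chart set \<Rightarrow> 'a metric_field \<Rightarrow> bool" where
  "riemannian_metric M A g \<longleftrightarrow>
     (\<forall>p\<in>topspace M. \<forall>u\<in>tangent_space M A p. \<forall>v\<in>tangent_space M A p.
        g p u v = g p v u \<and>
        (u \<noteq> tv_zero \<longrightarrow> g p u u > 0) \<and>
        (\<forall>w\<in>tangent_space M A p. \<forall>a b.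
           g p (tv_add (tv_scale a u) (tv_scale b v)) w = a * g p u w + b * g p v w)) \<and>
     (\<forall>X Y. smooth_vfield M A X \<longrightarrow> smooth_vfield M A Y \<longrightarrow> smooth_fun A (\<lambda>p. g p (X p) (Y p)))"

definition riemannian_manifold ::
    "'a topology \<Rightarrow> ('a, 'n::finite) chart set \<Rightarrow> 'a metric_field \<Rightarrow> bool" where
  "riemannian_manifold M A g \<longleftrightarrow> smooth_manifold M A \<and> riemannian_metric M A g"

type_synonym 'a connection = "'a vfield \<Rightarrow> 'a vfield \<Rightarrow> 'a vfield"

definition affine_connection ::
    "'a topology \<Rightarrow> ('a, 'n::finite) chart set \<Rightarrow> 'a connection \<Rightarrow> bool" where
  "affine_connection M A D \<longleftrightarrow>
     (\<forall>X Y. smooth_vfield M A X \<longrightarrow> smooth_vfield M A Y \<longrightarrow> smooth_vfield M A (D X Y)) \<and>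
     (\<forall>X Y Z f. smooth_vfield M A X \<longrightarrow> smooth_vfield M A Y \<longrightarrow> smooth_vfield M A Z \<longrightarrow>
        smooth_fun A f \<longrightarrow> (\<forall>p\<in>topspace M.
          D (\<lambda>q. tv_add (X q) (Y q)) Z p = tv_add (D X Z p) (D Y Z p) \<and>
          D (\<lambda>q. tv_scale (f q) (X q)) Z p = tv_scale (f p) (D X Z p) \<and>
          D X (\<lambda>q. tv_add (Y q) (Z q)) p = tv_add (D X Y p) (D X Z p) \<and>
          D X (\<lambda>q. tv_scale (f q) (Y q)) p =
            tv_add (tv_scale (f p) (D X Y p)) (tv_scale (X p f) (Y p))))"

definition torsion_free ::
    "'a topology \<Rightarrow> ('a, 'n::finite) chart set \<Rightarrow> 'a connection \<Rightarrow> bool" where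
  "torsion_free M A D \<longleftrightarrow>
     (\<forall>X Y. smooth_vfield M A X \<longrightarrow> smooth_vfield M A Y \<longrightarrow> (\<forall>p\<in>topspace M.
        tv_diff (D X Y p) (D Y X p) = lie_bracket X Y p))"

definition metric_compatible ::
    "'a topology \<Rightarrow> ('a, 'n::finite) chart set \<Rightarrow> 'a metric_field \<Rightarrow> 'a connection \<Rightarrow> bool" where
  "metric_compatible M A g D \<longleftrightarrow>
     (\<forall>X Y Z. smooth_vfield M A X \<longrightarrow> smooth_vfield M A Y \<longrightarrow> smooth_vfield M A Z \<longrightarrow>
        (\<forall>p\<in>topspace M.
          X p (\<lambda>q. g q (Y q) (Z q)) = g p (D X Y p) (Z p) + g p (Y p) (D X Z p)))"

text \<open>The three conditions determine \<open>D X Y p\<close> for smooth \<open>X\<close>, \<open>Y\<close> and \<open>p \<in> topspace M\<close> by the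
  fundamental theorem of Riemannian geometry; the remaining values, over which the choice operator
  is not unique, are never used below.\<close>

definition levi_civita ::
    "'a topology \<Rightarrow> ('a, 'n::finite) chart set \<Rightarrow> 'a metric_field \<Rightarrow> 'a connection" where
  "levi_civita M A g =
     (SOME D. affine_connection M A D \<and> torsion_free M A D \<and> metric_compatible M A g D)"

section \<open>Tensor fields and Riemann solitons\<close>

text \<open>Tensor fields are represented by their action on vector fields.\<close>

type_synonym 'a tensor2 = "'a vfield \<Rightarrow> 'a vfield \<Rightarrow> 'a \<Rightarrow> real"
type_synonym 'a tensor4 = "'a vfield \<Rightarrow> 'a vfield \<Rightarrow> 'a vfield \<Rightarrow> 'a vfield \<Rightarrow> 'a \<Rightarrow> real"

definition metric_tensor :: "'a metric_field \<Rightarrow> 'a tensor2" where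
  "metric_tensor g X Y p = g p (X p) (Y p)"

definition kulkarni_nomizu :: "'a tensor2 \<Rightarrow> 'a tensor2 \<Rightarrow> 'a tensor4" where
  "kulkarni_nomizu T1 T2 X Y Z W p =
     T1 X W p * T2 Y Z p + T1 Y Z p * T2 X W p - T1 X Z p * T2 Y W p - T1 Y W p * T2 X Z p"

definition curvature_op :: "'a connection \<Rightarrow> 'a vfield \<Rightarrow> 'a vfield \<Rightarrow> 'a vfield \<Rightarrow> 'a vfield" where
  "curvature_op D X Y Z p =
     tv_diff (tv_diff (D X (D Y Z) p) (D Y (D X Z) p)) (D (lie_bracket X Y) Z p)"

definition riemann_tensor ::
    "'a topology \<Rightarrow> ('a, 'n::finite) chart set \<Rightarrow> 'a metric_field \<Rightarrow> 'a tensor4" where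
  "riemann_tensor M A g X Y Z W p = g p (curvature_op (levi_civita M A g) X Y Z p) (W p)"

definition G_tensor :: "'a metric_field \<Rightarrow> 'a tensor4" where
  "G_tensor g X Y Z W p =
     1/2 * kulkarni_nomizu (metric_tensor g) (metric_tensor g) X Y Z W p"

definition lie_derivative :: "'a vfield \<Rightarrow> 'a tensor2 \<Rightarrow> 'a tensor2" where
  "lie_derivative V T X Y p =
     V p (T X Y) - T (lie_bracket V X) Y p - T X (lie_bracket V Y) p"

definition riemann_soliton ::
    "'a topology \<Rightarrow> ('a, 'n::finite) chart set \<Rightarrow> 'a metric_field \<Rightarrow> 'a vfield \<Rightarrow> real \<Rightarrow> bool" where
  "riemann_soliton M A g V lam \<longleftrightarrow>
     smooth_vfield M A V \<and>
     (\<forall>X Y Z W. smooth_vfield M A X \<longrightarrow> smooth_vfield M A Y \<longrightarrow>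
        smooth_vfield M A Z \<longrightarrow> smooth_vfield M A W \<longrightarrow> (\<forall>p\<in>topspace M.
          kulkarni_nomizu (\<lambda>X Y p. 1/2 * lie_derivative V (metric_tensor g) X Y p)
              (metric_tensor g) X Y Z W p
            + riemann_tensor M A g X Y Z W p
          = lam * G_tensor g X Y Z W p))"

definition is_gradient ::
    "'a topology \<Rightarrow> ('a, 'n::finite) chart set \<Rightarrow> 'a metric_field \<Rightarrow> 'a vfield \<Rightarrow> ('a \<Rightarrow> real) \<Rightarrow> bool"
  where
  "is_gradient M A g V f \<longleftrightarrow>
     smooth_vfield M A V \<and> (\<forall>p\<in>topspace M. \<forall>v\<in>tangent_space M A p. g p (V p) v = v f)"

definition gradient_riemann_soliton ::
    "'a topology \<Rightarrow> ('a, 'n::finite) chart set \<Rightarrow> 'a metric_field \<Rightarrow> 'a vfield \<Rightarrow> real \<Rightarrow> bool" where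
  "gradient_riemann_soliton M A g V lam \<longleftrightarrow>
     riemann_soliton M A g V lam \<and> (\<exists>f. smooth_fun A f \<and> is_gradient M A g V f)"

definition nontrivial_vfield :: "'a topology \<Rightarrow> 'a vfield \<Rightarrow> bool" where
  "nontrivial_vfield M V \<longleftrightarrow> (\<exists>p\<in>topspace M. V p \<noteq> tv_zero)"

definition constant_length :: "'a topology \<Rightarrow> 'a metric_field \<Rightarrow> 'a vfield \<Rightarrow> bool" where
  "constant_length M g V \<longleftrightarrow> (\<exists>c. \<forall>p\<in>topspace M. sqrt (g p (V p) (V p)) = c)"

end

theory Submission
  imports Defs
begin

text \<open>At a maximum point p of the potential f, f has zero derivative along every smooth curve
  through p, so each tangent vector at p annihilates f
  (\<open>tangent_vector_vanishes_at_max\<close>). Testing the gradient relation on the vector V p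
  itself gives g(V, V) = V p f = 0 there (\<open>compact_gradient_has_zero\<close>). Constant length
  spreads this zero to all of M, while positive definiteness makes the length positive wherever V is
  nonzero.\<close>

text \<open>By compactness the potential \<open>f\<close> attains its maximum, where \<open>V = grad f\<close> vanishes; so the
  constant length of \<open>V\<close> is zero.\<close>

lemma smooth_on_imp_continuous_on: "smooth_on S f \<Longrightarrow> continuous_on S f"
  unfolding smooth_on_def by (metis Ck_on.simps(1))

lemma smooth_on_imp_differentiable: "smooth_on S f \<Longrightarrow> x \<in> S \<Longrightarrow> f differentiable (at x)"
  unfolding smooth_on_def by (metis Ck_on.simps(2))

text \<open>This is what lets \<open>inv_into U \<phi>\<close> cancel \<phi> on U, so that f can be
  recovered from its coordinate expression.\<close>

lemma is_chart_inj_on: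
  assumes "is_chart M (U, \<phi>)"
  shows "inj_on \<phi> U"
proof -
  have "openin M U" "homeomorphic_map (subtopology M U) (top_of_set (\<phi> ` U)) \<phi>"
    using assms by (auto simp: is_chart_def)
  then show ?thesis
    by (metis homeomorphic_imp_injective_map openin_subset topspace_subtopology_subset)
qed

text \<open>Continuity is local, and on a chart domain f is its continuous coordinate expression
  composed with the chart map. Needed for f to attain its maximum.\<close>

lemma smooth_fun_imp_continuous_map:
  assumes M: "smooth_manifold M A" and f: "smooth_fun A f"
  shows "continuous_map M euclideanreal f"
\<comment> \<open>Every local piece is f itself, so agreement on overlaps is trivial.\<close>
proof (rule pasting_lemma[where I = A and T = fst and f = "\<lambda>_. f"])
  fix c assume c: "c \<in> A"
  obtain U \<phi> where c_eq: "c = (U, \<phi>)"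
    by (cases c)
  have ch: "is_chart M (U, \<phi>)"
    using M c c_eq unfolding smooth_manifold_def by blast
  then show "openin M (fst c)"
    by (simp add: is_chart_def c_eq)
  have hom: "homeomorphic_map (subtopology M U) (top_of_set (\<phi> ` U)) \<phi>"
    using ch by (simp add: is_chart_def)
  have "continuous_on (\<phi> ` U) (\<lambda>x. f (inv_into U \<phi> x))"
    using f c c_eq unfolding smooth_fun_def by (blast intro: smooth_on_imp_continuous_on)
  then have "continuous_map (subtopology M U) euclideanreal ((\<lambda>x. f (inv_into U \<phi> x)) \<circ> \<phi>)"
    using hom by (intro continuous_map_compose[of _ "top_of_set (\<phi> ` U)"])
      (auto simp: homeomorphic_imp_continuous_map)
  then have "continuous_map (subtopology M U) euclideanreal f"
    by (rule continuous_map_eq) (simp add: is_chart_inj_on[OF ch])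
  then show "continuous_map (subtopology M (fst c)) euclideanreal f"
    by (simp add: c_eq)
next
  fix p assume "p \<in> topspace M"
  then show "\<exists>c. c \<in> A \<and> p \<in> fst c \<and> f p = f p"
    using M unfolding smooth_manifold_def by force
qed simp

text \<open>Chain rule in a chart around \<gamma>(t): the curve in coordinates, followed by f in
  coordinates.\<close>

lemma smooth_fun_curve_differentiable:
  assumes M: "smooth_manifold M A" and f: "smooth_fun A f"
    and \<gamma>: "smooth_curve M A I \<gamma>" and I: "open I" "t \<in> I"
  shows "(\<lambda>s. f (\<gamma> s)) differentiable (at t)"
proof -
  have cont: "continuous_map (top_of_set I) M \<gamma>"
    using \<gamma> unfolding smooth_curve_def by blast
  have "\<gamma> t \<in> topspace M"
    using continuous_map_funspace[OF cont] I by auto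
  then obtain U \<phi> where c: "(U, \<phi>) \<in> A" and tU: "\<gamma> t \<in> U"
    using M unfolding smooth_manifold_def by blast
  have ch: "is_chart M (U, \<phi>)"
    using M c unfolding smooth_manifold_def by blast
  define J where "J = {s \<in> I. \<gamma> s \<in> U}"
  have "openin (top_of_set I) J"
    using openin_continuous_map_preimage[OF cont, of U] ch by (simp add: is_chart_def J_def)
  \<comment> \<open>Openness in the real line allows the composite through the chart, which equals f
    along \<gamma> only on J, to be replaced by it near t.\<close>
  then have J: "open J"
    using \<open>open I\<close> openin_open_eq by blast
  have tJ: "t \<in> J"
    using I tU by (simp add: J_def)
  have "smooth_on J (\<lambda>s. \<phi> (\<gamma> s))"
    using \<gamma> c unfolding smooth_curve_def J_def by blast
  then have d1: "(\<lambda>s. \<phi> (\<gamma> s)) differentiable (at t)"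
    using tJ by (rule smooth_on_imp_differentiable)
  have "smooth_on (\<phi> ` U) (\<lambda>x. f (inv_into U \<phi> x))"
    using f c unfolding smooth_fun_def by blast
  then have d2: "(\<lambda>x. f (inv_into U \<phi> x)) differentiable (at (\<phi> (\<gamma> t)))"
    using tU by (auto intro: smooth_on_imp_differentiable)
  have "(\<lambda>s. f (inv_into U \<phi> (\<phi> (\<gamma> s)))) differentiable (at t)"
    using differentiable_chain_at[OF d1 d2] by (simp add: o_def)
  then obtain D where "((\<lambda>s. f (inv_into U \<phi> (\<phi> (\<gamma> s)))) has_derivative D) (at t)"
    unfolding differentiable_def by blast
  then have "((\<lambda>s. f (\<gamma> s)) has_derivative D) (at t)"
    using J tJ
  proof (rule has_derivative_transform_within_open)
    show "f (inv_into U \<phi> (\<phi> (\<gamma> s))) = f (\<gamma> s)" if "s \<in> J" for s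
      using that is_chart_inj_on[OF ch] by (simp add: J_def)
  qed
  then show ?thesis
    unfolding differentiable_def by blast
qed

text \<open>Tangent vectors are velocities of curves, so this is Fermat's criterion for the real
  function f along \<gamma> at its maximum 0.\<close>

lemma tangent_vector_vanishes_at_max:
  assumes M: "smooth_manifold M A" and f: "smooth_fun A f"
    and max: "\<And>q. q \<in> topspace M \<Longrightarrow> f q \<le> f p"
    and v: "v \<in> tangent_space M A p"
  shows "v f = 0"
proof -
  obtain \<gamma> e where v_eq: "v = velocity A \<gamma>" and e: "e > 0"
    and \<gamma>: "smooth_curve M A {-e<..<e} \<gamma>" and \<gamma>0: "\<gamma> 0 = p"
    using v unfolding tangent_space_def by blast
  have "(\<lambda>s. f (\<gamma> s)) differentiable (at 0)"
    using smooth_fun_curve_differentiable[OF M f \<gamma>] e by simp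
  then obtain D where D: "((\<lambda>s. f (\<gamma> s)) has_real_derivative D) (at 0)"
    using real_differentiable_def by blast
  have "\<gamma> s \<in> topspace M" if "s \<in> {-e<..<e}" for s
    using \<gamma> that unfolding smooth_curve_def by (auto dest!: continuous_map_funspace)
  then have "D = 0"
    using max \<gamma>0 by (intro DERIV_local_max[OF D e]) (auto simp: abs_less_iff)
  then show ?thesis
    \<comment> \<open>Smoothness of f selects the derivative branch of \<open>velocity\<close>, not
      the default value 0.\<close>
    using D f by (simp add: v_eq velocity_def DERIV_imp_deriv)
qed

lemma compact_gradient_has_zero:
  assumes M: "riemannian_manifold M A g" and "compact_space M" and "topspace M \<noteq> {}"
    and f: "smooth_fun A f" and grad: "is_gradient M A g V f"
  shows "\<exists>p\<in>topspace M. g p (V p) (V p) = 0"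
proof -
  have sm: "smooth_manifold M A"
    using M by (simp add: riemannian_manifold_def)
  have "compact (f ` topspace M)"
    using image_compactin[OF _ smooth_fun_imp_continuous_map[OF sm f]] \<open>compact_space M\<close>
    by (simp add: compact_space_def)
  then obtain p where p: "p \<in> topspace M" and max: "\<And>q. q \<in> topspace M \<Longrightarrow> f q \<le> f p"
    using compact_attains_sup[of "f ` topspace M"] \<open>topspace M \<noteq> {}\<close> by auto
  have Vp: "V p \<in> tangent_space M A p"
    using grad p by (simp add: is_gradient_def smooth_vfield_def)
  then have "g p (V p) (V p) = V p f"
    using grad p by (simp add: is_gradient_def)
  also have "\<dots> = 0"
    using tangent_vector_vanishes_at_max[OF sm f max Vp] .
  finally show ?thesis using p by blast
qed

theorem theorem2p9:
  fixes M :: "'a topology"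
    and A :: "('a, 'n::finite) chart set"
    and g :: "'a metric_field"
  assumes "CARD('n) \<ge> 3"
    and "riemannian_manifold M A g"
    and "compact_space M"
  shows "\<not> (\<exists>V lam. gradient_riemann_soliton M A g V lam \<and>
            nontrivial_vfield M V \<and> constant_length M g V)"
proof
  assume "\<exists>V lam. gradient_riemann_soliton M A g V lam \<and>
            nontrivial_vfield M V \<and> constant_length M g V"
  then obtain V f c q where f: "smooth_fun A f" and grad: "is_gradient M A g V f"
    and q: "q \<in> topspace M" "V q \<noteq> tv_zero"
    and c: "\<And>p. p \<in> topspace M \<Longrightarrow> sqrt (g p (V p) (V p)) = c"
    unfolding gradient_riemann_soliton_def nontrivial_vfield_def constant_length_def by blast
  have "V q \<in> tangent_space M A q"
    using grad q by (simp add: is_gradient_def smooth_vfield_def)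
  then have pos: "g q (V q) (V q) > 0"
    using assms(2) q unfolding riemannian_manifold_def riemannian_metric_def by blast
  \<comment> \<open>The point q witnesses that M is nonempty, as attaining a maximum
    requires.\<close>
  obtain p where "p \<in> topspace M" "g p (V p) (V p) = 0"
    using compact_gradient_has_zero[OF assms(2,3) _ f grad] q by blast
  then have "c = 0"
    using c by fastforce
  then show False
    using c[OF q(1)] pos by simp
qed

end
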